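(* Let $0 < \mu \le L$, let $f \in \mathcal{S}_{\mu,L}^{1}(\mathbb{R}^d)$ and $g \in \mathcal{F}^0(\mathbb{R}^d)$, and let $\Phi = f + g$. Let $s > 0$ and let $G_s$ be the $s$-proximal subgradient operator associated with $f$ and $g$. Then for all $x, y \in \mathbb{R}^d$, $$\Phi(y - sG_s(y)) \leq \Phi(x) + \langle G_s(y), y - x\rangle - \left(s- \frac{s^2L}{2}\right) \|G_s(y)\|^2 - \frac{\mu}{2} \| y - x\|^2 .$$
   Context: $\|\cdot\|$ is the Euclidean norm and $\langle\cdot,\cdot\rangle$ the standard inner product on $\mathbb{R}^d$. $\mathcal{F}^0(\mathbb{R}^d)$ is the class of continuous convex functions $g:\mathbb{R}^d\to\mathbb{R}$. $\mathcal{S}_{\mu,L}^1(\mathbb{R}^d)$ is the class of differentiable functions $f \in \mathcal{F}^0(\mathbb{R}^d)$ that are $L$-smooth, i.e. $\|\nabla f(x) - \nabla f(y)\| \leq L \|x - y\|$ for all $x,y\in\mathbb{R}^d$, and $\mu$-strongly convex, i.e. $f(y) \geq f(x) + \langle \nabla f(x), y - x \rangle + \frac{\mu}{2} \|y - x\|^2$ for all $x,y\in\mathbb{R}^d$. For $s>0$, the $s$-proximal operator is $$P_s(x) := \arg\min_{y\in\mathbb{R}^d}\left\{ \frac{1}{2s}\left\| y - \left(x - s\nabla f(x)\right) \right\|^2 + g(y) \right\},$$ and the $s$-proximal subgradient operator is $G_s(x) := \frac{x - P_s(x)}{s}$, for $x\in\mathbb{R}^d$. *)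

theory Defs
  imports "HOL-Analysis.Analysis"
begin

text \<open>For a differentiable function the vector below exists and is unique; elsewhere the
  value is unspecified.\<close>

definition gradient :: "('a::euclidean_space \<Rightarrow> real) \<Rightarrow> 'a \<Rightarrow> 'a" where
  "gradient f x = (THE D. GDERIV f x :> D)"

definition cont_convex :: "('a::euclidean_space \<Rightarrow> real) set" where
  "cont_convex = {g. continuous_on UNIV g \<and> convex_on UNIV g}"

definition smooth_strongly_convex :: "real \<Rightarrow> real \<Rightarrow> ('a::euclidean_space \<Rightarrow> real) set" where
  "smooth_strongly_convex \<mu> L =
    {f \<in> cont_convex.
       (\<forall>x. f differentiable (at x)) \<and>
       (\<forall>x y. norm (gradient f x - gradient f y) \<le> L * norm (x - y)) \<and>
       (\<forall>x y. f y \<ge> f x + gradient f x \<bullet> (y - x) + \<mu> / 2 * (norm (y - x))\<^sup>2)}"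

text \<open>When \<open>s > 0\<close>, \<open>g\<close> is continuous and convex, the objective is continuous,
  strongly convex and coercive, so its minimiser exists and is unique, and the choice made by
  \<open>ARG_MIN\<close> is no choice at all.\<close>

definition prox_op ::
  "('a::euclidean_space \<Rightarrow> real) \<Rightarrow> ('a \<Rightarrow> real) \<Rightarrow> real \<Rightarrow> 'a \<Rightarrow> 'a" where
  "prox_op f g s x =
    (ARG_MIN (\<lambda>y. 1 / (2 * s) * (norm (y - (x - s *\<^sub>R gradient f x)))\<^sup>2 + g y) y. True)"

definition prox_subgrad ::
  "('a::euclidean_space \<Rightarrow> real) \<Rightarrow> ('a \<Rightarrow> real) \<Rightarrow> real \<Rightarrow> 'a \<Rightarrow> 'a" where
  "prox_subgrad f g s x = (x - prox_op f g s x) /\<^sub>R s"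

end

theory Submission
  imports Defs
begin

text \<open>Optimality of the proximal step says that \<open>G y - gradient f y\<close> is a subgradient of \<open>g\<close> at
  \<open>y - s *\<^sub>R G y\<close>. The claim is the sum of that subgradient inequality at \<open>x\<close>, the quadratic upper
  bound for \<open>f\<close> from \<open>y\<close> to \<open>y - s *\<^sub>R G y\<close>, and the strong convexity inequality from \<open>y\<close> to \<open>x\<close>.\<close>

text \<open>\<open>gradient\<close> is a definite description, so it has meaning only once existence
  and uniqueness are known. The adjoint of the derivative, applied to 1, is the Riesz vector
  representing that linear functional; uniqueness of the derivative fixes the vector.\<close>

lemma GDERIV_gradient:
  fixes f :: "'a::euclidean_space \<Rightarrow> real"
  assumes "f differentiable (at x)"
  shows "GDERIV f x :> gradient f x"
proof -
  obtain D where D: "(f has_derivative D) (at x)"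
    using assms unfolding differentiable_def by blast
  have "D = (\<lambda>h. h \<bullet> adjoint D 1)"
    using adjoint_works[OF has_derivative_linear[OF D], of _ 1] by auto
  with D have ex: "GDERIV f x :> adjoint D 1"
    unfolding gderiv_def by metis
  have uniq: "E = adjoint D 1" if "GDERIV f x :> E" for E
  proof -
    have "(\<lambda>h. h \<bullet> E) = (\<lambda>h. h \<bullet> adjoint D 1)"
      using has_derivative_unique that ex unfolding gderiv_def by blast
    then show ?thesis
      by (metis vector_eq_ldot)
  qed
  show ?thesis
    unfolding gradient_def by (rule theI[where P = "\<lambda>D. GDERIV f x :> D", OF ex uniq])
qed

text \<open>Along the segment from \<open>x\<close> to \<open>y\<close>, \<open>\<phi>\<close> is
  \<open>f\<close> minus its linear and quadratic model. Cauchy-Schwarz and the Lipschitz bound make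
  its derivative nonpositive on [0, 1], so comparing the endpoints replaces integration of the
  gradient.\<close>

lemma descent_lemma:
  fixes f :: "'a::euclidean_space \<Rightarrow> real"
  assumes diff: "\<And>x. f differentiable (at x)"
    and lip: "\<And>x y. norm (gradient f x - gradient f y) \<le> L * norm (x - y)"
  shows "f y \<le> f x + gradient f x \<bullet> (y - x) + L / 2 * (norm (y - x))\<^sup>2"
proof -
  define d where "d = y - x"
  define \<phi> where "\<phi> t = f (x + t *\<^sub>R d) - t * (gradient f x \<bullet> d) - L / 2 * t\<^sup>2 * (norm d)\<^sup>2" for t
  have deriv: "(\<phi> has_real_derivative
      (gradient f (x + t *\<^sub>R d) - gradient f x) \<bullet> d - L * t * (norm d)\<^sup>2) (at t)" for t
  proof -
    have line: "((\<lambda>t. x + t *\<^sub>R d) has_derivative (\<lambda>h. h *\<^sub>R d)) (at t)"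
      by (auto intro!: derivative_eq_intros)
    have "((\<lambda>t. f (x + t *\<^sub>R d)) has_derivative (\<lambda>h. (h *\<^sub>R d) \<bullet> gradient f (x + t *\<^sub>R d))) (at t)"
      using has_derivative_compose[OF line GDERIV_gradient[OF diff, unfolded gderiv_def]] .
    then have "((\<lambda>t. f (x + t *\<^sub>R d)) has_real_derivative gradient f (x + t *\<^sub>R d) \<bullet> d) (at t)"
      unfolding has_field_derivative_def
      by (rule has_derivative_eq_rhs) (auto simp: inner_commute mult.commute)
    then show ?thesis
      unfolding \<phi>_def by (auto intro!: derivative_eq_intros simp: inner_diff_left)
  qed
  have "\<phi> 1 \<le> \<phi> 0"
  proof (rule DERIV_nonpos_imp_nonincreasing[where f = \<phi>])
    fix t :: real
    assume t: "0 \<le> t" "t \<le> 1"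
    have "(gradient f (x + t *\<^sub>R d) - gradient f x) \<bullet> d
        \<le> norm (gradient f (x + t *\<^sub>R d) - gradient f x) * norm d"
      by (rule norm_cauchy_schwarz)
    also have "\<dots> \<le> (L * norm (t *\<^sub>R d)) * norm d"
      using lip[of "x + t *\<^sub>R d" x] by (intro mult_right_mono) auto
    also have "\<dots> = L * t * (norm d)\<^sup>2"
      using t by (simp add: power2_eq_square)
    finally show "\<exists>D. (\<phi> has_real_derivative D) (at t) \<and> D \<le> 0"
      using deriv[of t] by (intro exI conjI) auto
  qed simp
  then show ?thesis
    by (simp add: \<phi>_def d_def)
qed

text \<open>Coercivity reduces the problem to a compact ball: outside it the objective is at least
  its value at the centre \<open>w\<close>.\<close>

lemma prox_objective_has_minimizer:
  fixes g :: "'a::euclidean_space \<Rightarrow> real"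
  assumes cont: "continuous_on UNIV g" and conv: "convex_on UNIV g" and s: "s > 0"
  shows "\<exists>p. \<forall>z. 1 / (2 * s) * (norm (p - w))\<^sup>2 + g p \<le> 1 / (2 * s) * (norm (z - w))\<^sup>2 + g z"
proof -
  define h where "h z = 1 / (2 * s) * (norm (z - w))\<^sup>2 + g z" for z
  obtain m where m: "\<And>z. z \<in> cball w 1 \<Longrightarrow> m \<le> g z"
    using continuous_attains_inf[of "cball w 1" g] continuous_on_subset[OF cont]
    by (metis compact_cball cball_eq_empty not_one_less_zero subset_UNIV)
  \<comment> \<open>The 1 ensures that the segment from \<open>w\<close> to any point outside the
    ball crosses the unit sphere around \<open>w\<close>, where \<open>m\<close> bounds
    \<open>g\<close> below. The other term makes \<open>r\<^sup>2 / (2 * s)\<close> exceed the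
    possible decrease \<open>r * (g w - m)\<close>.\<close>
  define R where "R = max 1 (2 * s * (g w - m))"
  have conth: "continuous_on (cball w R) h"
    unfolding h_def
    by (intro continuous_intros continuous_on_subset[OF cont]) auto
  obtain p where p: "\<And>z. z \<in> cball w R \<Longrightarrow> h p \<le> h z"
    using continuous_attains_inf[OF _ _ conth] unfolding R_def by force
  have "h p \<le> h z" for z
  proof (cases "z \<in> cball w R")
    case False
    define r where "r = norm (z - w)"
    have r: "r > 1" "r > 2 * s * (g w - m)"
      using False by (auto simp: R_def r_def dist_norm norm_minus_commute)
    text \<open>The unit-sphere point on the segment from \<open>w\<close> to \<open>z\<close> forces \<open>g\<close> to decrease at
      most linearly, so the quadratic term dominates.\<close>
    define q where "q = (1 - 1 / r) *\<^sub>R w + (1 / r) *\<^sub>R z"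
    have "q - w = (1 / r) *\<^sub>R (z - w)"
      by (simp add: q_def algebra_simps)
    then have "norm (q - w) = 1"
      using r by (auto simp: r_def)
    then have "m \<le> g q"
      by (intro m) (simp add: dist_norm norm_minus_commute)
    also have "g q \<le> (1 - 1 / r) * g w + (1 / r) * g z"
      unfolding q_def using r by (intro convex_onD[OF conv]) auto
    finally have "r * m \<le> r * ((1 - 1 / r) * g w + (1 / r) * g z)"
      using r by (intro mult_left_mono) auto
    also have "\<dots> = (r - 1) * g w + g z"
      using r by (simp add: field_simps)
    finally have gz: "g w - r * (g w - m) \<le> g z"
      by (simp add: algebra_simps)
    have "r * (2 * s * (g w - m)) \<le> r * r"
      using r by (intro mult_left_mono) auto
    then have "r * (g w - m) \<le> 1 / (2 * s) * r\<^sup>2"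
      using s by (simp add: field_simps power2_eq_square)
    with gz have "h w \<le> h z"
      by (simp add: h_def r_def)
    moreover have "h p \<le> h w"
      by (rule p) (simp add: R_def)
    ultimately show ?thesis
      by simp
  qed (rule p)
  then show ?thesis
    unfolding h_def by blast
qed

text \<open>Moving from \<open>p\<close> a fraction \<open>t\<close> of the way to \<open>z\<close>
  cannot lower the objective. By convexity of \<open>g\<close> the change is at most
  \<open>t * (A + t * B)\<close>; dividing by \<open>t\<close> and letting it tend to 0 from the
  right leaves \<open>0 \<le> A\<close>, the first-order optimality condition.\<close>

lemma prox_minimizer_subgradient:
  fixes g :: "'a::euclidean_space \<Rightarrow> real"
  assumes conv: "convex_on UNIV g" and s: "s > 0"
    and min: "\<And>z. 1 / (2 * s) * (norm (p - w))\<^sup>2 + g p \<le> 1 / (2 * s) * (norm (z - w))\<^sup>2 + g z"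
  shows "g p + ((w - p) /\<^sub>R s) \<bullet> (z - p) \<le> g z"
proof -
  define A where "A = g z - g p - ((w - p) /\<^sub>R s) \<bullet> (z - p)"
  have A: "A = g z - g p - ((w - p) \<bullet> (z - p)) / s"
    by (simp add: A_def divide_inverse_commute flip: scaleR_diff_right)
  define B where "B = (norm (z - p))\<^sup>2 / (2 * s)"
  have perturb: "0 \<le> A + t * B" if t: "0 < t" "t \<le> 1" for t
  proof -
    define q where "q = (1 - t) *\<^sub>R p + t *\<^sub>R z"
    have diff: "q - w = (p - w) + t *\<^sub>R (z - p)"
      by (simp add: q_def algebra_simps)
    have sq: "(norm (q - w))\<^sup>2
        = (norm (p - w))\<^sup>2 - 2 * t * ((w - p) \<bullet> (z - p)) + t\<^sup>2 * (norm (z - p))\<^sup>2"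
      unfolding power2_norm_eq_inner diff
      by (simp add: inner_add_left inner_add_right inner_diff_left inner_diff_right inner_commute
          power2_eq_square algebra_simps)
    have "g q \<le> (1 - t) * g p + t * g z"
      unfolding q_def using t by (intro convex_onD[OF conv]) auto
    with min[of q] have "0 \<le> 1 / (2 * s) * ((norm (q - w))\<^sup>2 - (norm (p - w))\<^sup>2) + t * (g z - g p)"
      by (simp add: algebra_simps)
    also have "\<dots> = t * (A + t * B)"
      unfolding sq A B_def using s by (simp add: field_simps power2_eq_square)
    finally show ?thesis
      using t by (simp add: zero_le_mult_iff)
  qed
  have "((\<lambda>t. A + t * B) \<longlongrightarrow> A + 0 * B) (at_right 0)"
    by (intro tendsto_intros)
  moreover have "\<forall>\<^sub>F t in at_right 0. 0 \<le> A + t * B"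
    unfolding eventually_at_right_field using perturb by (intro exI[of _ 1]) auto
  ultimately have "0 \<le> A + 0 * B"
    by (rule tendsto_lowerbound) simp
  then show ?thesis
    by (simp add: A_def)
qed

text \<open>Existence of a minimiser is what gives the choice made by \<open>ARG_MIN\<close> the
  minimising property.\<close>

lemma prox_op_minimizes:
  assumes "g \<in> cont_convex" and "s > 0"
  shows "1 / (2 * s) * (norm (prox_op f g s x - (x - s *\<^sub>R gradient f x)))\<^sup>2 + g (prox_op f g s x)
    \<le> 1 / (2 * s) * (norm (z - (x - s *\<^sub>R gradient f x)))\<^sup>2 + g z"
proof -
  let ?h = "\<lambda>z. 1 / (2 * s) * (norm (z - (x - s *\<^sub>R gradient f x)))\<^sup>2 + g z"
  have "\<exists>p. is_arg_min ?h (\<lambda>_. True) p"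
    using prox_objective_has_minimizer[of g s "x - s *\<^sub>R gradient f x"] assms
    unfolding is_arg_min_linorder cont_convex_def by simp
  then have "is_arg_min ?h (\<lambda>_. True) (prox_op f g s x)"
    unfolding prox_op_def arg_min_def by (rule someI_ex)
  then show ?thesis
    unfolding is_arg_min_linorder by simp
qed

theorem lemma3p2:
  fixes f g \<Phi> :: "real ^ 'd \<Rightarrow> real"
    and G :: "real ^ 'd \<Rightarrow> real ^ 'd"
    and \<mu> L s :: real
    and x y :: "real ^ 'd"
  assumes "0 < \<mu>" and "\<mu> \<le> L"
    and "f \<in> smooth_strongly_convex \<mu> L"
    and "g \<in> cont_convex"
    and "s > 0"
  defines "\<Phi> \<equiv> \<lambda>z. f z + g z"
    and "G \<equiv> prox_subgrad f g s"
  shows "\<Phi> (y - s *\<^sub>R G y) \<le>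
    \<Phi> x + G y \<bullet> (y - x) - (s - s\<^sup>2 * L / 2) * (norm (G y))\<^sup>2 - \<mu> / 2 * (norm (y - x))\<^sup>2"
proof -
  define p where "p = prox_op f g s y"
  define a where "a = gradient f y"
  have G: "G y = (y - p) /\<^sub>R s"
    by (simp add: G_def prox_subgrad_def p_def)
  have p: "y - s *\<^sub>R G y = p"
    using \<open>s > 0\<close> by (simp add: G)
  have subgrad: "(y - s *\<^sub>R a - p) /\<^sub>R s = G y - a"
    using \<open>s > 0\<close> by (simp add: G algebra_simps)
  have "g p + (G y - a) \<bullet> (x - p) \<le> g x"
    using prox_minimizer_subgradient[where w = "y - s *\<^sub>R a" and p = p and z = x and s = s and g = g]
      prox_op_minimizes[OF \<open>g \<in> cont_convex\<close> \<open>s > 0\<close>, of f y] assms(4,5)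
    unfolding subgrad by (simp add: cont_convex_def p_def a_def)
  \<comment> \<open>Splitting at \<open>y\<close> isolates the term in the squared norm of
    \<open>G y\<close> and leaves a multiple of \<open>a \<bullet> G y\<close> that cancels against
    the one in \<open>f_bound\<close>; the terms \<open>a \<bullet> (x - y)\<close> cancel against
    \<open>sc\<close>.\<close>
  moreover have "x - p = (x - y) + s *\<^sub>R G y"
    using p by (simp add: algebra_simps)
  ultimately have g_bound: "g p + (G y - a) \<bullet> (x - y) + s * ((norm (G y))\<^sup>2 - a \<bullet> G y) \<le> g x"
    by (simp add: power2_norm_eq_inner inner_add_right inner_diff_left algebra_simps)
  have "f p \<le> f y + a \<bullet> (p - y) + L / 2 * (norm (p - y))\<^sup>2"
    unfolding a_def using assms(3) by (intro descent_lemma) (auto simp: smooth_strongly_convex_def)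
  moreover have "p - y = - (s *\<^sub>R G y)"
    using p by (simp add: algebra_simps)
  ultimately have f_bound: "f p \<le> f y - s * (a \<bullet> G y) + s\<^sup>2 * L / 2 * (norm (G y))\<^sup>2"
    by (simp add: power_mult_distrib mult_ac)
  have sc: "f y + a \<bullet> (x - y) + \<mu> / 2 * (norm (y - x))\<^sup>2 \<le> f x"
    using assms(3) unfolding a_def smooth_strongly_convex_def by (auto simp: norm_minus_commute[of y x])
  show ?thesis
    unfolding p using g_bound f_bound sc
    by (simp add: \<Phi>_def inner_diff_left inner_diff_right algebra_simps)
qed

end
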